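(* Let $D=(V,A)$ be a finite connected directed acyclic graph with $V=\{1,\ldots,n\}$, whose vertices are ordered so that $u<v$ whenever $(u,v)\in A$, and suppose that $D$ has at least one topological additive numbering. Let $Q\subseteq V$ be a (nonempty) clique of $D$, and let $q_F$ and $q_L$ be the smallest and largest vertices of $Q$, respectively. Then $$\eta_t(D)\ \geq\ \left\lceil \frac{d(q_F)+1}{d(q_L)-|Q|+2}\right\rceil .$$
   Context: For a directed acyclic graph $D=(V,A)$, $G(D)$ denotes its undirected underlying graph, $N(v)$ denotes the set of neighbors of $v$ in $G(D)$ (both in- and out-neighbors), and $d(v)=|N(v)|$. A clique of $D$ is a set of vertices that are pairwise adjacent in $G(D)$. $\mathbb{N}$ denotes the positive integers. For a labeling $f:V\to\mathbb{N}$, put $S(v)=\sum_{w\in N(v)}f(w)$. The labeling $f$ is a topological additive numbering of $D$ if $S(u)<S(v)$ for every $(u,v)\in A$; it is a topological additive $k$-numbering if moreover $k$ is the largest label used in $f$. If $D$ has at least one topological additive numbering, $\eta_t(D)$ is the least $k$ for which $D$ has a topological additive $k$-numbering. *)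

theory Defs
  imports Complex_Main "Graph_Theory.Graph_Theory"
begin

text \<open>
  A directed graph \<open>D = (V, A)\<close> is a \<^typ>\<open>'a pair_pre_digraph\<close>, whose arcs are ordered pairs of
  vertices. Its undirected underlying graph is represented by the symmetric digraph
  \<^term>\<open>mk_symmetric (with_proj D)\<close>, as is done for \<^const>\<open>Digraph_Component.connected\<close>.
\<close>

definition neighbors :: "'a pair_pre_digraph \<Rightarrow> 'a \<Rightarrow> 'a set" where
  "neighbors D v = {w \<in> pverts D. (v, w) \<in> parcs (mk_symmetric (with_proj D))}"

definition degree :: "'a pair_pre_digraph \<Rightarrow> 'a \<Rightarrow> nat" where
  "degree D v = card (neighbors D v)"

definition is_clique :: "'a pair_pre_digraph \<Rightarrow> 'a set \<Rightarrow> bool" where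
  "is_clique D Q \<longleftrightarrow> Q \<subseteq> pverts D \<and> (\<forall>u\<in>Q. \<forall>v\<in>Q. u \<noteq> v \<longrightarrow> v \<in> neighbors D u)"

definition neighbor_sum :: "'a pair_pre_digraph \<Rightarrow> ('a \<Rightarrow> nat) \<Rightarrow> 'a \<Rightarrow> nat" where
  "neighbor_sum D f v = (\<Sum>w\<in>neighbors D v. f w)"

text \<open>Labels are positive integers; values of \<open>f\<close> outside the vertex set play no role.\<close>

definition top_add_numbering :: "'a pair_pre_digraph \<Rightarrow> ('a \<Rightarrow> nat) \<Rightarrow> bool" where
  "top_add_numbering D f \<longleftrightarrow>
     (\<forall>v\<in>pverts D. f v \<ge> 1) \<and>
     (\<forall>(u, v)\<in>parcs D. neighbor_sum D f u < neighbor_sum D f v)"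

definition top_add_k_numbering :: "'a pair_pre_digraph \<Rightarrow> nat \<Rightarrow> ('a \<Rightarrow> nat) \<Rightarrow> bool" where
  "top_add_k_numbering D k f \<longleftrightarrow> top_add_numbering D f \<and> k = Max (f ` pverts D)"

text \<open>Meaningful only if \<open>D\<close> is finite and nonempty and has a topological additive numbering.\<close>

definition eta_t :: "'a pair_pre_digraph \<Rightarrow> nat" where
  "eta_t D = (LEAST k. \<exists>f. top_add_k_numbering D k f)"

end

theory Submission
  imports Defs
begin

text \<open>
  Along a clique the sums \<open>S\<close> strictly increase, so \<open>S(q\<^sub>L) - S(q\<^sub>F) \<ge> |Q| - 1\<close>. On the other hand
  the labels of \<open>Q\<close> other than \<open>f(q\<^sub>F)\<close> and \<open>f(q\<^sub>L)\<close> occur in both sums and cancel. Bounding the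
  remaining labels below by 1 in \<open>S(q\<^sub>F)\<close> and above by the maximal label in \<open>S(q\<^sub>L)\<close> gives the claim.
\<close>

lemma in_neighbors_iff:
  "w \<in> neighbors D v \<longleftrightarrow> w \<in> pverts D \<and> ((v, w) \<in> parcs D \<or> (w, v) \<in> parcs D)"
  by (auto simp: neighbors_def parcs_mk_symmetric intro: bexI[of _ "(w, v)"])

lemma finite_neighbors: "finite (pverts D) \<Longrightarrow> finite (neighbors D v)"
  by (simp add: neighbors_def)

text \<open>Distinct clique vertices are joined by an arc, and since arcs go upward in the vertex
  order, it must point from the smaller to the larger.\<close>

lemma neighbor_sum_strict_mono_on_clique:
  fixes D :: "'a::linorder pair_pre_digraph"
  assumes "top_add_numbering D f" and "is_clique D Q"
    and "\<And>u v. (u, v) \<in> parcs D \<Longrightarrow> u < v"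
  shows "strict_mono_on Q (neighbor_sum D f)"
proof (rule strict_mono_onI)
  fix u v assume "u \<in> Q" "v \<in> Q" "u < v"
  then have "v \<in> neighbors D u"
    using assms(2) by (auto simp: is_clique_def)
  then have "(u, v) \<in> parcs D"
    using assms(3) \<open>u < v\<close> by (fastforce simp: in_neighbors_iff)
  then show "neighbor_sum D f u < neighbor_sum D f v"
    using assms(1) by (auto simp: top_add_numbering_def)
qed

text \<open>\<open>g\<close> is injective on \<open>Q\<close> with values between
  \<open>g (Min Q)\<close> and \<open>g (Max Q)\<close>, so that interval has at least
  \<open>card Q\<close> elements. The \<open>+ 1\<close> on the right avoids subtraction on
  naturals.\<close>

lemma card_le_of_strict_mono_on:
  fixes g :: "'a::linorder \<Rightarrow> nat"
  assumes "strict_mono_on Q g" and "finite Q" and "Q \<noteq> {}"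
  shows "g (Min Q) + card Q \<le> g (Max Q) + 1"
proof -
  have "mono_on Q g"
    using assms(1) by (rule strict_mono_on_imp_mono_on)
  then have le: "g (Min Q) \<le> g x" "g x \<le> g (Max Q)" if "x \<in> Q" for x
    using that assms(2,3) by (auto intro: mono_onD[of Q g] Min_in Max_in Min_le Max_ge)
  have "inj_on g Q"
    using assms(1) by (rule strict_mono_on_imp_inj_on)
  then have "card Q = card (g ` Q)"
    by (simp add: card_image)
  also have "\<dots> \<le> card {g (Min Q)..g (Max Q)}"
    using le by (intro card_mono) auto
  finally show ?thesis
    using le(1)[of "Max Q"] assms(2,3) by simp
qed

text \<open>The closed neighborhood of \<open>q\<close> contains the whole clique. Adding
  \<open>f q\<close> to the neighbor sum leaves the term \<open>sum f Q\<close>, which does not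
  depend on \<open>q\<close> and so cancels when two clique vertices are compared.\<close>

lemma neighbor_sum_clique_split:
  assumes "finite (pverts D)" and "is_clique D Q" and "q \<in> Q"
    and "q \<notin> neighbors D q"
  shows "neighbor_sum D f q + f q = sum f Q + sum f (neighbors D q - Q)"
    and "degree D q + 1 = card Q + card (neighbors D q - Q)"
proof -
  have fin: "finite Q" "finite (neighbors D q)"
    using assms(1,2) by (auto simp: is_clique_def finite_neighbors intro: finite_subset)
  have "insert q (neighbors D q) = Q \<union> (neighbors D q - Q)"
    using assms(2,3) by (auto simp: is_clique_def)
  \<comment> \<open>Kept general in \<open>h\<close>: the labeling gives the sum identity, the
    constant 1 gives the degree identity.\<close>
  then have split: "sum h (insert q (neighbors D q)) = sum h Q + sum h (neighbors D q - Q)"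
    for h :: "'a \<Rightarrow> nat"
    using fin by (metis Diff_disjoint finite_Diff sum.union_disjoint)
  show "neighbor_sum D f q + f q = sum f Q + sum f (neighbors D q - Q)"
    using split[of f] fin assms(4) by (simp add: neighbor_sum_def)
  show "degree D q + 1 = card Q + card (neighbors D q - Q)"
    using split[of "\<lambda>_. 1"] fin assms(4) by (simp add: degree_def)
qed

text \<open>The claimed bound with the fraction cleared:
  \<open>card (neighbors D (Max Q) - Q) + 1\<close> equals d(q_L) - |Q| + 2, written so as to be
  visibly positive.\<close>

lemma clique_degree_bound:
  fixes D :: "'a::linorder pair_pre_digraph"
  assumes "finite (pverts D)" and "is_clique D Q" and "Q \<noteq> {}"
    and "\<And>u v. (u, v) \<in> parcs D \<Longrightarrow> u < v"
    and "top_add_k_numbering D k f"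
  shows "degree D (Min Q) + 1 \<le> k * (card (neighbors D (Max Q) - Q) + 1)"
proof -
  let ?S = "neighbor_sum D f" and ?F = "Min Q" and ?L = "Max Q"
  have f: "top_add_numbering D f"
    using assms(5) by (simp add: top_add_k_numbering_def)
  have f_ge: "1 \<le> f v" if "v \<in> pverts D" for v
    using f that by (simp add: top_add_numbering_def)
  have f_le: "f v \<le> k" if "v \<in> pverts D" for v
    using assms(1,5) that by (simp add: top_add_k_numbering_def)
  have Q: "Q \<subseteq> pverts D"
    using assms(2) by (simp add: is_clique_def)
  then have "finite Q"
    using assms(1) finite_subset by blast
  then have FL: "?F \<in> Q" "?L \<in> Q"
    using assms(3) by auto
  \<comment> \<open>A loop would be an arc from \<open>v\<close> to \<open>v\<close>, forcing
    \<open>v < v\<close>.\<close>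
  have irrefl: "v \<notin> neighbors D v" for v
    using assms(4)[of v v] by (auto simp: in_neighbors_iff)
  note F = neighbor_sum_clique_split[OF assms(1,2) FL(1) irrefl]
  note L = neighbor_sum_clique_split[OF assms(1,2) FL(2) irrefl]
  have "?S ?F + card Q \<le> ?S ?L + 1"
    using neighbor_sum_strict_mono_on_clique[OF f assms(2,4)] \<open>finite Q\<close> assms(3)
    by (rule card_le_of_strict_mono_on)
  moreover have "card (neighbors D ?F - Q) \<le> sum f (neighbors D ?F - Q)"
    using sum_mono[of "neighbors D ?F - Q" "\<lambda>_. 1" f] f_ge by (auto simp: in_neighbors_iff)
  moreover have "sum f (neighbors D ?L - Q) \<le> k * card (neighbors D ?L - Q)"
    using sum_bounded_above[of "neighbors D ?L - Q" f k] f_le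
    by (auto simp: in_neighbors_iff mult.commute)
  moreover have "f ?F \<le> k" "1 \<le> f ?L"
    using f_le f_ge FL Q by auto
  \<comment> \<open>After \<open>sum f Q\<close> cancels, \<open>f ?F\<close> moves to the right and
    costs at most one extra \<open>k\<close>, while \<open>1 \<le> f ?L\<close> absorbs the
    \<open>+ 1\<close> from the clique count.\<close>
  ultimately show ?thesis
    using F(1)[of f] F(2) L(1)[of f] by simp
qed

theorem proposition1:
  fixes D :: "nat pair_pre_digraph" and n :: nat and Q :: "nat set"
  assumes "pair_digraph D"
    and "acyclic (parcs D)"
    and "Digraph_Component.connected (with_proj D)"
    and "pverts D = {1..n}"
    and "\<And>u v. (u, v) \<in> parcs D \<Longrightarrow> u < v"
    and "\<exists>f. top_add_numbering D f"
    and "is_clique D Q" and "Q \<noteq> {}"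
  shows "int (eta_t D) \<ge>
    \<lceil>(real (degree D (Min Q)) + 1) / (real (degree D (Max Q)) - real (card Q) + 2)\<rceil>"
proof -
  let ?c = "card (neighbors D (Max Q) - Q)"
  have fin: "finite (pverts D)"
    using assms(4) by simp
  \<comment> \<open>Every numbering is a \<open>k\<close>-numbering for its own maximal label, so
    the minimum defining \<open>eta_t D\<close> is attained.\<close>
  have "\<exists>k f. top_add_k_numbering D k f"
    using assms(6) by (auto simp: top_add_k_numbering_def)
  then obtain f where f: "top_add_k_numbering D (eta_t D) f"
    unfolding eta_t_def using LeastI_ex[of "\<lambda>k. \<exists>f. top_add_k_numbering D k f"] by blast
  have "finite Q"
    using assms(7) fin by (auto simp: is_clique_def intro: finite_subset)
  then have "Max Q \<in> Q"
    using assms(8) by simp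
  moreover have "Max Q \<notin> neighbors D (Max Q)"
    using assms(5) by (auto simp: in_neighbors_iff)
  ultimately have "degree D (Max Q) + 1 = card Q + ?c"
    by (rule neighbor_sum_clique_split(2)[OF fin assms(7)])
  \<comment> \<open>The denominator is the cast of a positive natural number, so the inequality may
    be divided by it.\<close>
  then have denom: "real (degree D (Max Q)) - real (card Q) + 2 = real (?c + 1)"
    by simp
  have "real (degree D (Min Q) + 1) \<le> real (eta_t D * (?c + 1))"
    using clique_degree_bound[OF fin assms(7,8,5) f] by (simp only: of_nat_le_iff)
  then have "(real (degree D (Min Q)) + 1) / real (?c + 1) \<le> real (eta_t D)"
    by (subst pos_divide_le_eq) (simp_all add: algebra_simps)
  then show ?thesis
    unfolding denom by (simp only: ceiling_le_iff of_int_of_nat_eq)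
qed

end
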